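(* Let $n\ge1$, $L\ge1$. In the stationary state of the skin-deep de Bruijn process on $G^{n,L}$, the probability that site $i$ is occupied by letter $a$ is uniform: for every $i$ with $1\le i\le L$ and every $a\in\Sigma$, $$\langle\eta^{a,i}\rangle=\frac1n .$$
   Context: Let $\Sigma=\{1,\dots,n\}$ and let $\Sigma^L$ be the set of words of length $L$ over $\Sigma$. For a word $u=u_1\cdots u_L$ put $h(u)=u_1\cdots u_{L-1}$ and $t(u)=u_2\cdots u_L$ (the empty word if $L=1$). The de Bruijn graph $G^{n,L}$ has vertex set $\Sigma^L$ and an edge from $u$ to $v$ if and only if $h(v)=t(u)$. Skin-deep de Bruijn process: let $x$ be a formal variable (all probabilities are rational functions of $x$). For a nonempty word $v$ put $\beta_x(v)=x$ if the last block of $v$ (the maximal suffix consisting of repetitions of a single letter) has length $1$, and $\beta_x(v)=1$ if the last block has length greater than $1$. The process is the continuous-time Markov chain on $\Sigma^L$ in which the transition $u\to v$ along an edge of $G^{n,L}$ has rate $\beta_x(v)$. Its stationary distribution is the unique vector $(\bar\mu_x(u))_{u\in\Sigma^L}$ with $\sum_{u\in\Sigma^L}\bar\mu_x(u)=1$ and, for each $v\in\Sigma^L$, $$\sum_{u\in\Sigma^L:\,t(u)=h(v)}\beta_x(v)\,\bar\mu_x(u)=\Big(\sum_{a\in\Sigma}\beta_x(t(v).a)\Big)\bar\mu_x(v).$$ $\eta^{a,i}$ is the random variable equal to $1$ if the $i$-th letter of the word is $a$ and $0$ otherwise, and $\langle\cdot\rangle$ denotes expectation with respect to $\bar\mu_x$.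 *)

theory Defs
  imports "HOL-Computational_Algebra.Computational_Algebra"
begin

definition words :: "nat \<Rightarrow> nat \<Rightarrow> nat list set" where
  "words n L = {u. length u = L \<and> set u \<subseteq> {1..n}}"

text \<open>For a word \<open>u\<close>, \<open>h(u)\<close> is \<^term>\<open>butlast u\<close> and \<open>t(u)\<close> is \<^term>\<open>tl u\<close>.\<close>

definition de_bruijn_edges :: "nat \<Rightarrow> nat \<Rightarrow> (nat list \<times> nat list) set" where
  "de_bruijn_edges n L = {(u, v) \<in> words n L \<times> words n L. butlast v = tl u}"

definition last_block_length :: "nat list \<Rightarrow> nat" where
  "last_block_length v = length (takeWhile (\<lambda>c. c = last v) (rev v))"

text \<open>Only the values on nonempty words matter.\<close>

definition skin_deep_rate :: "'a::field \<Rightarrow> nat list \<Rightarrow> 'a" where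
  "skin_deep_rate x v = (if last_block_length v = 1 then x else 1)"

text \<open>A vector indexed by \<^term>\<open>words n L\<close> is a function that vanishes off that set;
  the vanishing condition makes such a function determined by its entries. Loops of the
  graph contribute to both sides of the balance equation.\<close>

definition is_stationary :: "'a::field \<Rightarrow> nat \<Rightarrow> nat \<Rightarrow> (nat list \<Rightarrow> 'a) \<Rightarrow> bool" where
  "is_stationary x n L \<mu> \<longleftrightarrow>
     (\<forall>u. u \<notin> words n L \<longrightarrow> \<mu> u = 0) \<and>
     (\<Sum>u\<in>words n L. \<mu> u) = 1 \<and>
     (\<forall>v\<in>words n L.
        (\<Sum>u | (u, v) \<in> de_bruijn_edges n L. skin_deep_rate x v * \<mu> u) =
        (\<Sum>a\<in>{1..n}. skin_deep_rate x (tl v @ [a])) * \<mu> v)"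

definition stationary_distribution :: "'a::field \<Rightarrow> nat \<Rightarrow> nat \<Rightarrow> nat list \<Rightarrow> 'a" where
  "stationary_distribution x n L = (THE \<mu>. is_stationary x n L \<mu>)"

definition stationary_expectation ::
    "'a::field \<Rightarrow> nat \<Rightarrow> nat \<Rightarrow> (nat list \<Rightarrow> 'a) \<Rightarrow> 'a" where
  "stationary_expectation x n L f = (\<Sum>u\<in>words n L. f u * stationary_distribution x n L u)"

text \<open>Sites are numbered from 1, list positions from 0.\<close>

definition occupation :: "nat \<Rightarrow> nat \<Rightarrow> nat list \<Rightarrow> 'a::field" where
  "occupation a i u = (if u ! (i - 1) = a then 1 else 0)"

text \<open>The indeterminate of the field of rational functions over the rationals.\<close>

definition formal_x :: "rat poly fract" where
  "formal_x = Fract [:0, 1:] 1"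

end

(* For L \<ge> 2 a word of length L - 1 \<ge> 1 has total extension rate C = 1 + (n - 1) x,
   so summing the balance equations over the last letter shows that the first L - 1 and the last
   L - 1 letters have the same distribution.  Hence all sites have the same one-letter marginal m,
   and the balance equations say that the word is read off a Markov chain with transition weights
   1 / C (repeat the letter) and x / C (change it).  Thus C m(b) = m(b) + x (1 - m(b)), which forces
   m(b) = 1 / n.  The same recursion determines the stationary vector as a product of transition
   weights, which gives the existence and uniqueness needed for the definite description. *)
theory Submission
  imports Defs
begin

declare One_nat_def [simp del]

section \<open>Words and sums over them, split at the first or the last letter\<close>

lemma words_0: "words n 0 = {[]}"
  by (auto simp: words_def)

lemma Cons_in_words: "c # w \<in> words n (Suc k) \<longleftrightarrow> c \<in> {1..n} \<and> w \<in> words n k"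
  by (auto simp: words_def)

lemma snoc_in_words: "w @ [c] \<in> words n (Suc k) \<longleftrightarrow> c \<in> {1..n} \<and> w \<in> words n k"
  by (auto simp: words_def)

lemma words_Suc_Cons: "words n (Suc k) = (\<lambda>(c, w). c # w) ` ({1..n} \<times> words n k)"
  by (force simp: words_def length_Suc_conv image_iff)

lemma words_Suc_snoc: "words n (Suc k) = (\<lambda>(c, w). w @ [c]) ` ({1..n} \<times> words n k)"
proof
  show "words n (Suc k) \<subseteq> (\<lambda>(c, w). w @ [c]) ` ({1..n} \<times> words n k)"
  proof
    fix u assume u: "u \<in> words n (Suc k)"
    then have "u = butlast u @ [last u]"
      by (cases u rule: rev_cases) (auto simp: words_def)
    then show "u \<in> (\<lambda>(c, w). w @ [c]) ` ({1..n} \<times> words n k)"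
      using u snoc_in_words[of "butlast u" "last u" n k] by force
  qed
qed (use snoc_in_words in auto)

lemma last_letter_in:
  assumes "w \<in> words n k" "w \<noteq> []"
  shows "last w \<in> {1..n}"
  using assms by (cases w rule: rev_cases) (auto simp: words_def)

lemma sum_words_Cons:
  "(\<Sum>u\<in>words n (Suc k). f u) = (\<Sum>w\<in>words n k. \<Sum>c\<in>{1..n}. f (c # w))"
proof -
  have "(\<Sum>u\<in>words n (Suc k). f u) = (\<Sum>(c, w)\<in>{1..n} \<times> words n k. f (c # w))"
    unfolding words_Suc_Cons
    by (subst sum.reindex) (auto simp: inj_on_def case_prod_unfold)
  also have "\<dots> = (\<Sum>c\<in>{1..n}. \<Sum>w\<in>words n k. f (c # w))"
    by (simp add: sum.cartesian_product)
  finally show ?thesis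
    by (simp only: sum.swap[of _ "words n k"])
qed

lemma sum_words_snoc:
  "(\<Sum>u\<in>words n (Suc k). f u) = (\<Sum>w\<in>words n k. \<Sum>c\<in>{1..n}. f (w @ [c]))"
proof -
  have "(\<Sum>u\<in>words n (Suc k). f u) = (\<Sum>(c, w)\<in>{1..n} \<times> words n k. f (w @ [c]))"
    unfolding words_Suc_snoc
    by (subst sum.reindex) (auto simp: inj_on_def case_prod_unfold)
  also have "\<dots> = (\<Sum>c\<in>{1..n}. \<Sum>w\<in>words n k. f (w @ [c]))"
    by (simp add: sum.cartesian_product)
  finally show ?thesis
    by (simp only: sum.swap[of _ "words n k"])
qed

section \<open>Balance equations in terms of letters\<close>

lemma de_bruijn_predecessors:
  assumes "w \<in> words n k" "b \<in> {1..n}"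
  shows "{u. (u, w @ [b]) \<in> de_bruijn_edges n (Suc k)} = (\<lambda>c. c # w) ` {1..n}"
proof -
  have "(u, w @ [b]) \<in> de_bruijn_edges n (Suc k) \<longleftrightarrow> (\<exists>c\<in>{1..n}. u = c # w)" for u
  proof (cases u)
    case Nil
    then show ?thesis
      by (simp add: de_bruijn_edges_def words_def)
  next
    case (Cons c u')
    then show ?thesis
      using assms by (auto simp: de_bruijn_edges_def Cons_in_words snoc_in_words)
  qed
  then show ?thesis by auto
qed

text \<open>The predecessors of \<open>w @ [b]\<close> are the words \<open>c # w\<close>, so the
  incoming mass is the same for every \<open>b\<close> and only the rate depends on it.\<close>

lemma is_stationary_iff:
  "is_stationary x n (Suc k) \<mu> \<longleftrightarrow>
     (\<forall>u. u \<notin> words n (Suc k) \<longrightarrow> \<mu> u = 0) \<and>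
     (\<Sum>u\<in>words n (Suc k). \<mu> u) = 1 \<and>
     (\<forall>w\<in>words n k. \<forall>b\<in>{1..n}.
        skin_deep_rate x (w @ [b]) * (\<Sum>c\<in>{1..n}. \<mu> (c # w)) =
        (\<Sum>a\<in>{1..n}. skin_deep_rate x (tl (w @ [b]) @ [a])) * \<mu> (w @ [b]))"
proof -
  have pred: "(\<Sum>u | (u, w @ [b]) \<in> de_bruijn_edges n (Suc k). skin_deep_rate x (w @ [b]) * \<mu> u)
      = skin_deep_rate x (w @ [b]) * (\<Sum>c\<in>{1..n}. \<mu> (c # w))"
    if "w \<in> words n k" "b \<in> {1..n}" for w b
    unfolding de_bruijn_predecessors[OF that]
    by (subst sum.reindex) (auto simp: sum_distrib_left inj_on_def)
  have all_words: "(\<forall>v\<in>words n (Suc k). P v) \<longleftrightarrow> (\<forall>w\<in>words n k. \<forall>b\<in>{1..n}. P (w @ [b]))" for P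
    unfolding words_Suc_snoc by fastforce
  then show ?thesis
    unfolding is_stationary_def all_words by (intro conj_cong ball_cong refl) (simp only: pred)
qed

lemma skin_deep_rate_singleton: "skin_deep_rate x [b] = x"
  by (simp add: skin_deep_rate_def last_block_length_def)

text \<open>The last block of \<open>w @ [b]\<close> has length 1 exactly when \<open>b\<close>
  differs from the letter before it.\<close>

lemma skin_deep_rate_snoc:
  assumes "w \<noteq> []"
  shows "skin_deep_rate x (w @ [b]) = (if last w = b then 1 else x)"
  using assms by (cases w rule: rev_cases) (auto simp: skin_deep_rate_def last_block_length_def)

text \<open>One letter repeats \<open>a\<close> and the other \<open>n - 1\<close> change it; this
  gives total rates and row sums of \<open>transition\<close>.\<close>

lemma sum_repeat_or_change:
  fixes x y z :: "'a::field"
  assumes "a \<in> {1..n}"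
  shows "(\<Sum>b\<in>{1..n}. if a = b then y else z) = y + (of_nat n - 1) * z"
proof -
  have "(\<Sum>b\<in>{1..n}. if a = b then y else z) = y + (\<Sum>b\<in>{1..n} - {a}. z)"
    using assms by (subst sum.remove[of _ a]) (auto intro!: sum.cong)
  then show ?thesis
    using assms by (simp add: of_nat_diff)
qed

text \<open>The argument works over any field in which the quantities to be divided by are nonzero:
  \<open>x\<close>, \<open>n\<close> and the total exit rate C of a word of length at least
  2.\<close>

locale skin_deep_field =
  fixes x :: "'a::field" and n :: nat
  assumes x_nonzero: "x \<noteq> 0"
    and n_nonzero: "(of_nat n :: 'a) \<noteq> 0"
    and total_nonzero: "1 + (of_nat n - 1) * x \<noteq> 0"
begin

definition transition :: "nat \<Rightarrow> nat \<Rightarrow> 'a" where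
  "transition a b = (if a = b then 1 else x) / (1 + (of_nat n - 1) * x)"

text \<open>Path probability of the Markov chain with matrix \<open>transition\<close> started from
  the uniform law; the candidate for the stationary vector.\<close>

fun weight :: "nat list \<Rightarrow> 'a" where
  "weight [] = 1"
| "weight [a] = 1 / of_nat n"
| "weight (a # b # w) = transition a b * weight (b # w)"

lemma transition_commute: "transition a b = transition b a"
  by (simp add: transition_def eq_commute)

lemma sum_transition:
  assumes "a \<in> {1..n}"
  shows "(\<Sum>b\<in>{1..n}. transition a b) = 1"
  unfolding transition_def
  using sum_repeat_or_change[OF assms, of 1 x] total_nonzero
  by (simp flip: sum_divide_distrib)

lemma sum_rates_snoc:
  assumes "w \<in> words n k" "w \<noteq> []"
  shows "(\<Sum>a\<in>{1..n}. skin_deep_rate x (w @ [a])) = 1 + (of_nat n - 1) * x"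
proof -
  have "last w \<in> {1..n}"
    using assms by (rule last_letter_in)
  then show ?thesis
    using assms sum_repeat_or_change[of "last w" n 1 x] by (simp add: skin_deep_rate_snoc)
qed

text \<open>For length at least 2 the tail of \<open>w @ [b]\<close> is nonempty, so the exit rate
  is C for every word and can be divided out. Length 1 differs: there the exit rate is
  \<open>n * x\<close>.\<close>

lemma stationary_iff_transition:
  "is_stationary x n (Suc (Suc k)) \<mu> \<longleftrightarrow>
     (\<forall>u. u \<notin> words n (Suc (Suc k)) \<longrightarrow> \<mu> u = 0) \<and>
     (\<Sum>u\<in>words n (Suc (Suc k)). \<mu> u) = 1 \<and>
     (\<forall>w\<in>words n (Suc k). \<forall>b\<in>{1..n}.
        \<mu> (w @ [b]) = transition (last w) b * (\<Sum>c\<in>{1..n}. \<mu> (c # w)))"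
proof -
  have balance: "(skin_deep_rate x (w @ [b]) * (\<Sum>c\<in>{1..n}. \<mu> (c # w)) =
        (\<Sum>a\<in>{1..n}. skin_deep_rate x (tl (w @ [b]) @ [a])) * \<mu> (w @ [b])) \<longleftrightarrow>
        \<mu> (w @ [b]) = transition (last w) b * (\<Sum>c\<in>{1..n}. \<mu> (c # w))"
    if w: "w \<in> words n (Suc k)" and b: "b \<in> {1..n}" for w b
  proof -
    have ne: "w \<noteq> []" using w by (auto simp: words_def)
    then obtain d w' where "w = d # w'" by (cases w) auto
    then have "tl (w @ [b]) \<in> words n (Suc k)" "tl (w @ [b]) \<noteq> []"
      using w b by (auto simp: Cons_in_words snoc_in_words)
    then have total: "(\<Sum>a\<in>{1..n}. skin_deep_rate x (tl (w @ [b]) @ [a])) = 1 + (of_nat n - 1) * x"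
      by (rule sum_rates_snoc)
    have "r * S = C * m \<longleftrightarrow> m = r / C * S" if "C \<noteq> 0" for r S C m :: 'a
      using that by (auto simp: field_simps)
    from this[OF total_nonzero] show ?thesis
      unfolding total transition_def skin_deep_rate_snoc[OF ne] .
  qed
  then show ?thesis
    unfolding is_stationary_iff by (intro conj_cong ball_cong refl) (simp only: balance)
qed

lemma stationary_singleton:
  assumes "is_stationary x n (Suc 0) \<mu>" "b \<in> {1..n}"
  shows "\<mu> [b] = 1 / of_nat n"
proof -
  \<comment> \<open>One-letter words all have rate \<open>x\<close>, and every such word precedes
    every other.\<close>
  have "x * (\<Sum>c\<in>{1..n}. \<mu> [c]) = of_nat n * x * \<mu> [b]" "(\<Sum>c\<in>{1..n}. \<mu> [c]) = 1"
    using assms is_stationary_iff[of x n 0 \<mu>]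
    by (auto simp: words_0 sum_words_Cons skin_deep_rate_singleton)
  then show ?thesis
    using x_nonzero n_nonzero by (simp add: field_simps)
qed

text \<open>Summing the transition form of balance over \<open>b\<close> removes the factor
  \<open>transition (last w) b\<close>, whose row sum is 1.\<close>

lemma marginal_shift:
  assumes "is_stationary x n (Suc (Suc k)) \<mu>" "w \<in> words n (Suc k)"
  shows "(\<Sum>b\<in>{1..n}. \<mu> (w @ [b])) = (\<Sum>c\<in>{1..n}. \<mu> (c # w))"
proof -
  have "last w \<in> {1..n}"
    using assms(2) by (rule last_letter_in) (use assms(2) in \<open>auto simp: words_def\<close>)
  then show ?thesis
    using assms by (simp add: stationary_iff_transition sum_transition flip: sum_distrib_right)
qed

lemma last_letter_uniform:
  assumes st: "is_stationary x n (Suc k) \<mu>" and b: "b \<in> {1..n}"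
  shows "(\<Sum>w\<in>words n k. \<mu> (w @ [b])) = 1 / of_nat n"
proof (cases k)
  case 0
  then show ?thesis
    using stationary_singleton[of \<mu> b] assms by (simp add: words_0)
next
  case (Suc j)
  let ?C = "1 + (of_nat n - 1) * x"
  let ?m = "\<Sum>w\<in>words n k. \<mu> (w @ [b])"
  \<comment> \<open>A transition weight is a constant \<open>p\<close> plus a correction
    \<open>q\<close> for repeating the letter. The constant meets the total mass 1, the correction
    meets the marginal itself.\<close>
  define p where "p = x / ?C"
  define q where "q = (1 - x) / ?C"
  have transition_split: "transition d b = p + (if d = b then q else 0)" for d
    by (simp add: transition_def p_def q_def flip: add_divide_distrib)
  have total: "(\<Sum>u\<in>words n (Suc k). \<mu> u) = 1"
    using st by (simp add: is_stationary_def)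
  have "?m = (\<Sum>w\<in>words n k. transition (last w) b * (\<Sum>c\<in>{1..n}. \<mu> (c # w)))"
    using st b unfolding Suc by (simp add: stationary_iff_transition)
  also have "\<dots> = (\<Sum>u\<in>words n (Suc k). transition (last u) b * \<mu> u)"
    unfolding sum_words_Cons
  proof (intro sum.cong refl)
    fix w assume "w \<in> words n k"
    \<comment> \<open>As \<open>w\<close> is nonempty, \<open>w\<close> and \<open>c # w\<close>
      have the same last letter.\<close>
    then have "w \<noteq> []"
      using Suc by (auto simp: words_def)
    then show "transition (last w) b * (\<Sum>c\<in>{1..n}. \<mu> (c # w))
        = (\<Sum>c\<in>{1..n}. transition (last (c # w)) b * \<mu> (c # w))"
      by (simp add: sum_distrib_left)
  qed
  also have "\<dots> = (\<Sum>u\<in>words n (Suc k). p * \<mu> u + (if last u = b then q * \<mu> u else 0))"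
    by (intro sum.cong refl) (simp add: transition_split distrib_right)
  also have "\<dots> = p + (\<Sum>u\<in>words n (Suc k). if last u = b then q * \<mu> u else 0)"
    by (simp add: sum.distrib total flip: sum_distrib_left)
  also have "(\<Sum>u\<in>words n (Suc k). if last u = b then q * \<mu> u else 0) = q * ?m"
    unfolding sum_words_snoc using b by (simp add: sum_distrib_left)
  finally have "?C * ?m = ?C * (p + q * ?m)"
    by (rule arg_cong)
  also have "\<dots> = ?C * p + ?C * q * ?m"
    by (simp only: distrib_left mult.assoc)
  also have "\<dots> = x + (1 - x) * ?m"
    using total_nonzero by (simp add: p_def q_def)
  finally have "?C * ?m = x + (1 - x) * ?m" .
  \<comment> \<open>The coefficients of the marginal combine to C - (1 - x) = n x.\<close>
  then have "x * (of_nat n * ?m - 1) = 0"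
    by (simp add: algebra_simps)
  then have "of_nat n * ?m = 1"
    using x_nonzero by simp
  then show ?thesis
    using n_nonzero by (simp add: field_simps)
qed

text \<open>Downward induction on the position, starting from the last letter:
  \<open>marginal_shift\<close> carries position \<open>j\<close> to position
  \<open>Suc j\<close>.\<close>

lemma site_uniform:
  assumes st: "is_stationary x n (Suc k) \<mu>" and a: "a \<in> {1..n}" and "j \<le> k"
  shows "(\<Sum>u\<in>words n (Suc k). if u ! j = a then \<mu> u else 0) = 1 / of_nat n"
  using \<open>j \<le> k\<close>
proof (induction rule: inc_induct)
  case base
  have "(\<Sum>u\<in>words n (Suc k). if u ! k = a then \<mu> u else 0) = (\<Sum>w\<in>words n k. \<mu> (w @ [a]))"
    unfolding sum_words_snoc
    using a by (intro sum.cong refl) (auto simp: words_def nth_append)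
  then show ?case
    using last_letter_uniform[OF st a] by simp
next
  case (step j)
  then obtain k' where k: "k = Suc k'"
    by (cases k) auto
  have "(\<Sum>u\<in>words n (Suc k). if u ! j = a then \<mu> u else 0)
      = (\<Sum>w\<in>words n k. if w ! j = a then \<Sum>b\<in>{1..n}. \<mu> (w @ [b]) else 0)"
    unfolding sum_words_snoc using step.hyps
    by (intro sum.cong refl) (auto simp: words_def nth_append)
  also have "\<dots> = (\<Sum>w\<in>words n k. if w ! j = a then \<Sum>c\<in>{1..n}. \<mu> (c # w) else 0)"
    using marginal_shift st unfolding k by (intro sum.cong refl) auto
  also have "\<dots> = (\<Sum>u\<in>words n (Suc k). if u ! Suc j = a then \<mu> u else 0)"
    unfolding sum_words_Cons by (intro sum.cong refl) auto
  finally show ?case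
    using step.IH by simp
qed

section \<open>Uniqueness: the stationary vector as a product of transition weights\<close>

lemma weight_snoc:
  assumes "w \<noteq> []"
  shows "weight (w @ [b]) = transition (last w) b * weight w"
  using assms by (induction w rule: weight.induct) (auto simp: mult_ac)

text \<open>Induction by appending letters: the one-letter case is
  \<open>last_letter_uniform\<close>, and each further letter contributes one transition factor by
  balance. At full length only the empty prefix remains, which determines \<open>\<mu>\<close>
  itself.\<close>

lemma suffix_marginal:
  assumes st: "is_stationary x n L \<mu>" and "w \<noteq> []" "w \<in> words n (length w)" "length w \<le> L"
  shows "(\<Sum>p\<in>words n (L - length w). \<mu> (p @ w)) = weight w"
  using assms(2-)
proof (induction w rule: rev_induct)
  case Nil
  then show ?case by simp
next
  case (snoc b w)
  then have b: "b \<in> {1..n}" and w: "w \<in> words n (length w)"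
    by (auto simp: snoc_in_words)
  define m where "m = L - length (w @ [b])"
  show ?case
  proof (cases "w = []")
    case True
    then show ?thesis
      using last_letter_uniform[of "L - 1" \<mu> b] st b snoc.prems by (cases L) auto
  next
    case False
    then obtain k where L: "L = Suc (Suc k)"
      using snoc.prems by (cases L; cases "L - 1") auto
    \<comment> \<open>The prefix before \<open>w\<close> has one letter more than the prefix before
      \<open>w @ [b]\<close>; the incoming letter \<open>c\<close> of the balance equation supplies
      it.\<close>
    have m: "L - length w = Suc m" "m + length w = Suc k"
      using snoc.prems L by (auto simp: m_def)
    have "(\<Sum>p\<in>words n m. \<mu> (p @ w @ [b]))
        = (\<Sum>p\<in>words n m. transition (last w) b * (\<Sum>c\<in>{1..n}. \<mu> (c # p @ w)))"
    proof (intro sum.cong refl)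
      fix p assume "p \<in> words n m"
      then have "p @ w \<in> words n (Suc k)"
        using w m by (auto simp: words_def)
      then have "\<mu> ((p @ w) @ [b]) = transition (last (p @ w)) b * (\<Sum>c\<in>{1..n}. \<mu> (c # p @ w))"
        using st b unfolding L stationary_iff_transition by blast
      then show "\<mu> (p @ w @ [b]) = transition (last w) b * (\<Sum>c\<in>{1..n}. \<mu> (c # p @ w))"
        using False by simp
    qed
    also have "\<dots> = transition (last w) b * (\<Sum>p\<in>words n (L - length w). \<mu> (p @ w))"
      unfolding m(1) sum_words_Cons by (simp add: sum_distrib_left)
    also have "\<dots> = weight (w @ [b])"
      using snoc.IH False w snoc.prems by (simp add: weight_snoc)
    finally show ?thesis
      by (simp add: m_def)
  qed
qed

lemma stationary_eq_weight:
  assumes "is_stationary x n L \<mu>" "L \<ge> 1"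
  shows "\<mu> = (\<lambda>u. if u \<in> words n L then weight u else 0)"
proof
  fix u
  show "\<mu> u = (if u \<in> words n L then weight u else 0)"
  proof (cases "u \<in> words n L")
    case True
    then have "length u = L" "u \<noteq> []"
      using assms(2) by (auto simp: words_def)
    then show ?thesis
      using suffix_marginal[OF assms(1), of u] True by (simp add: words_0)
  qed (use assms in \<open>simp add: is_stationary_def\<close>)
qed

section \<open>Existence: the product of transition weights is stationary\<close>

lemma sum_weight_Cons:
  assumes "w \<in> words n (Suc k)"
  shows "(\<Sum>c\<in>{1..n}. weight (c # w)) = weight w"
proof -
  obtain d w' where w: "w = d # w'" and d: "d \<in> {1..n}"
    using assms by (cases w) (auto simp: words_def)
  \<comment> \<open>Symmetry of \<open>transition\<close> turns the column sum into a row sum; this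
    is why the uniform initial law is invariant.\<close>
  have "(\<Sum>c\<in>{1..n}. weight (c # w)) = (\<Sum>c\<in>{1..n}. transition d c) * weight w"
    by (simp add: w transition_commute[of d] sum_distrib_right)
  then show ?thesis
    using sum_transition[OF d] by simp
qed

lemma sum_weight: "(\<Sum>u\<in>words n (Suc k). weight u) = 1"
proof (induction k)
  case 0
  then show ?case
    using n_nonzero by (simp add: sum_words_Cons words_0)
next
  case (Suc k)
  then show ?case
    by (simp add: sum_words_Cons[of _ _ "Suc k"] sum_weight_Cons cong: sum.cong)
qed

lemma weight_stationary:
  assumes "L \<ge> 1"
  shows "is_stationary x n L (\<lambda>u. if u \<in> words n L then weight u else 0)"
proof -
  obtain k where L: "L = Suc k"
    using assms by (cases L) auto
  show ?thesis
  proof (cases k)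
    case 0
    then show ?thesis
      using n_nonzero sum_weight[of 0]
      by (simp add: L is_stationary_iff words_0 skin_deep_rate_singleton
          Cons_in_words[of _ "[]" n 0, simplified])
  next
    case (Suc j)
    have "weight (w @ [b]) = transition (last w) b * (\<Sum>c\<in>{1..n}. weight (c # w))"
      if "w \<in> words n (Suc j)" for w b
      using that sum_weight_Cons[OF that] by (subst weight_snoc) (auto simp: words_def)
    then show ?thesis
      using sum_weight[of k]
      by (simp add: L Suc stationary_iff_transition Cons_in_words[of _ _ n "Suc j"]
          snoc_in_words[of _ _ n "Suc j"])
  qed
qed

text \<open>Existence and uniqueness together make the definite description denote a stationary
  vector.\<close>

lemma stationary_distribution_stationary:
  assumes "L \<ge> 1"
  shows "is_stationary x n L (stationary_distribution x n L)"
  unfolding stationary_distribution_def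
proof (rule theI'[where P = "is_stationary x n L"], rule ex1I)
  show "is_stationary x n L (\<lambda>u. if u \<in> words n L then weight u else 0)"
    using assms by (rule weight_stationary)
  show "\<mu> = (\<lambda>u. if u \<in> words n L then weight u else 0)" if "is_stationary x n L \<mu>" for \<mu>
    using that assms by (rule stationary_eq_weight)
qed

end

section \<open>The formal variable and the uniform occupation probability\<close>

lemma skin_deep_field_formal_x:
  assumes "n \<ge> 1"
  shows "skin_deep_field formal_x n"
proof
  show "formal_x \<noteq> 0"
    by (simp add: formal_x_def Zero_fract_def eq_fract)
  show "(of_nat n :: rat poly fract) \<noteq> 0"
    using assms by (simp add: of_nat_fract Zero_fract_def eq_fract)
  have "(1 + (of_nat n - 1) * formal_x :: rat poly fract) = Fract (1 + (of_nat n - 1) * [:0, 1:]) 1"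
    by (simp add: formal_x_def of_nat_fract One_fract_def)
  moreover have "(1 + (of_nat n - 1) * [:0, 1:] :: rat poly) \<noteq> 0"
  proof
    assume "(1 + (of_nat n - 1) * [:0, 1:] :: rat poly) = 0"
    \<comment> \<open>Evaluating at 0 leaves the constant term 1.\<close>
    then have "poly (1 + (of_nat n - 1) * [:0, 1:] :: rat poly) 0 = poly 0 0"
      by (rule arg_cong)
    then show False by simp
  qed
  ultimately show "(1 + (of_nat n - 1) * formal_x :: rat poly fract) \<noteq> 0"
    by (simp add: Zero_fract_def eq_fract)
qed

theorem corollary15:
  fixes n L i a :: nat
  assumes "n \<ge> 1" and "L \<ge> 1"
    and "1 \<le> i" and "i \<le> L" and "a \<in> {1..n}"
  shows "stationary_expectation formal_x n L (occupation a i) = 1 / of_nat n"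
proof -
  interpret skin_deep_field formal_x n
    using assms(1) by (rule skin_deep_field_formal_x)
  have "Suc (L - 1) = L"
    using assms(2) by simp
  \<comment> \<open>Site \<open>i\<close> is list position \<open>i - 1\<close>, and
    \<open>i \<le> L\<close> places it within the range of \<open>site_uniform\<close> for
    \<open>k = L - 1\<close>.\<close>
  then have "(\<Sum>u\<in>words n L. if u ! (i - 1) = a then stationary_distribution formal_x n L u else 0)
      = 1 / of_nat n"
    using site_uniform[of "L - 1" "stationary_distribution formal_x n L" a "i - 1"]
      stationary_distribution_stationary[of L] assms
    by (simp add: diff_le_mono)
  then show ?thesis
    by (simp add: stationary_expectation_def occupation_def if_distrib[where f = "\<lambda>y. y * _"] cong: if_cong)
qed

end
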